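(* Let $\mu$ be a non-trivial probability measure supported on $[-1,1]$, $\sigma=\mathrm{Sz}(\mu)$ its Szegő transformation, and $F$ the $\mathcal C$-function of $\sigma$. Let $k\ge1$ be an integer, let $\{P^{(-k)}_n\}_{n\ge0}$ be the anti-associated polynomials of order $k$ obtained from new coefficients $b_{1-k},\dots,b_0$ and $d_{1-k},\dots,d_0$, whose orthogonality measure is assumed to be supported on $[-1,1]$, and let $\widetilde F^{(-k)}$ be the $\mathcal C$-function corresponding to them through the Szegő transformation. Then $$\frac{2z}{1-z^2}\widetilde F^{(-k)}(z)\ \dot=\ \boldsymbol B^{(-k)}\!\left(\frac{z+z^{-1}}2\right)\left(\frac{2z}{1-z^2}F(z)\right),$$ where $$\boldsymbol B^{(-k)}(x)=\begin{bmatrix}\widetilde d_kP^{(-k+1)}_{k-2}(x)&-P^{(-k+1)}_{k-1}(x)\\ \widetilde d_kP^{(-k)}_{k-1}(x)&-P^{(-k)}_k(x)\end{bmatrix},\qquad 2x=z+z^{-1}.$$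
   Context: Notation $\dot=$: for a $2\times2$ matrix of functions, $f\ \dot=\ \begin{bmatrix}a&b\\c&d\end{bmatrix}g$ means $f=\dfrac{a g+b}{c g+d}$. The monic orthogonal polynomials $P_n$ of $\mu$ satisfy $P_{n+1}(x)=(x-b_{n+1})P_n(x)-d_nP_{n-1}(x)$, $n\ge0$, $P_{-1}=0$, $P_0=1$, with $b_n\in\mathbb R$, $d_n>0$ for $n\ge1$. Anti-associated polynomials: given new numbers $b_{-i}\in\mathbb R$ and $d_{-i}>0$ ($i=k-1,\dots,0$), for each $0\le j\le k$ let $\{P_n^{(-j)}\}$ be the monic sequence with $P^{(-j)}_{-1}=0$, $P^{(-j)}_0=1$, $P^{(-j)}_{n+1}(x)=(x-b_{n+1-j})P^{(-j)}_n(x)-d_{n-j}P^{(-j)}_{n-1}(x)$, $n\ge0$ (the term with $P^{(-j)}_{-1}$ being zero). Thus $P_n^{(0)}=P_n$, and $P_n^{(-j)}$ is the anti-associated sequence of order $j$; here $d_0$ is one of the new coefficients. Put $\widetilde d_n=d_{n-k}$ for $n\ge1$, so $\widetilde d_k=d_0$. Let $\mu^{(-k)}$ be the orthogonality probability measure of $\{P^{(-k)}_n\}$. Szegő transformation: a probability measure $\nu$ on $[-1,1]$ is sent to the probability measure $\mathrm{Sz}(\nu)$ on the unit circle given by $d\,\mathrm{Sz}(\nu)(\theta)=\frac12|d\nu(\cos\theta)|$, i.e. the measure invariant under $\theta\mapsto-\theta$ whose push-forward under $e^{i\theta}\mapsto\cos\theta$ is $\nu$. The $\mathcal C$-function of a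 probability measure $\sigma$ on the unit circle is $F_\sigma(z)=\int_{-\pi}^{\pi}\frac{e^{i\theta}+z}{e^{i\theta}-z}\,d\sigma(\theta)$, $|z|<1$. Here $\widetilde F^{(-k)}$ is the $\mathcal C$-function of $\mathrm{Sz}(\mu^{(-k)})$. The variable $z$ ranges over $0<|z|<1$. *)

theory Defs
  imports "HOL-Probability.Probability" "HOL-Computational_Algebra.Polynomial"
begin

section \<open>Measures on the real line and orthogonal polynomials\<close>

definition msupport :: "'a::topological_space measure \<Rightarrow> 'a set" where
  "msupport M = {x. \<forall>U. open U \<longrightarrow> x \<in> U \<longrightarrow> emeasure M U \<noteq> 0}"

definition prob_on_interval :: "real measure \<Rightarrow> bool" where
  "prob_on_interval M \<longleftrightarrow>
     prob_space M \<and> sets M = sets borel \<and> msupport M \<subseteq> {-1..1}"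

definition nontrivial_measure :: "real measure \<Rightarrow> bool" where
  "nontrivial_measure M \<longleftrightarrow> infinite (msupport M)"

definition monic_orthogonal :: "real measure \<Rightarrow> (nat \<Rightarrow> real poly) \<Rightarrow> bool" where
  "monic_orthogonal M p \<longleftrightarrow>
     (\<forall>n. degree (p n) = n \<and> lead_coeff (p n) = 1) \<and>
     (\<forall>m n. m \<noteq> n \<longrightarrow> (LINT x|M. poly (p m) x * poly (p n) x) = 0)"

text \<open>
  The coefficient sequences are indexed by integers: the entries with index at least 1 belong to
  the original measure, those with index at most 0 are the new ones.
  In \<open>antiassoc_aux b d j\<close> the index is shifted by one, so that the value at \<open>0\<close> is the
  initial polynomial \<open>0\<close> of index \<open>-1\<close> and the value at \<open>Suc n\<close> is the polynomial of degree \<open>n\<close>.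
\<close>

fun antiassoc_aux :: "(int \<Rightarrow> real) \<Rightarrow> (int \<Rightarrow> real) \<Rightarrow> nat \<Rightarrow> nat \<Rightarrow> real poly" where
  "antiassoc_aux b d j 0 = 0"
| "antiassoc_aux b d j (Suc 0) = 1"
| "antiassoc_aux b d j (Suc (Suc n)) =
     [:- b (int n + 1 - int j), 1:] * antiassoc_aux b d j (Suc n)
     - smult (d (int n - int j)) (antiassoc_aux b d j n)"

text \<open>\<open>antiassoc b d j n\<close> is $P^{(-j)}_n$, for all integers $n \ge -1$.\<close>

definition antiassoc :: "(int \<Rightarrow> real) \<Rightarrow> (int \<Rightarrow> real) \<Rightarrow> nat \<Rightarrow> int \<Rightarrow> real poly" where
  "antiassoc b d j n = antiassoc_aux b d j (nat (n + 1))"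

lemma antiassoc_minus_one: "antiassoc b d j (-1) = 0"
  by (simp add: antiassoc_def)

lemma antiassoc_zero: "antiassoc b d j 0 = 1"
  by (simp add: antiassoc_def)

lemma antiassoc_rec:
  assumes "n \<ge> 0"
  shows "antiassoc b d j (n + 1) =
           [:- b (n + 1 - int j), 1:] * antiassoc b d j n
           - smult (d (n - int j)) (antiassoc b d j (n - 1))"
proof -
  obtain m where m: "n = int m" using assms nonneg_int_cases by blast
  have "nat (n + 1 + 1) = Suc (Suc m)" "nat (n + 1) = Suc m" "nat (n - 1 + 1) = m"
    using m by auto
  then show ?thesis by (simp add: antiassoc_def m)
qed

section \<open>The Szeg\H{o} transformation and the C-function\<close>

text \<open>
  The image measure under $t \mapsto e^{\pm i \arccos t}$, the sign being chosen uniformly at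
  random. This realises $d\sigma(\theta) = \frac12 |d\nu(\cos\theta)|$ as a Borel measure on the
  complex plane concentrated on the unit circle; the lemmas below recover the characterisation
  by invariance under conjugation and by the push-forward under the real part.
\<close>

definition Sz :: "real measure \<Rightarrow> complex measure" where
  "Sz \<nu> = distr (uniform_count_measure {-1, 1::real} \<Otimes>\<^sub>M \<nu>) borel
            (\<lambda>(s, t). cis (s * arccos t))"

definition C_function :: "complex measure \<Rightarrow> complex \<Rightarrow> complex" where
  "C_function \<sigma> z = (LINT w|\<sigma>. (w + z) / (w - z))"

lemma arccos_measurable [measurable]: "arccos \<in> borel_measurable borel"
proof -
  have const: "arccos t = (THE x. False)" if "t \<notin> {-1..1}" for t :: real
  proof -
    have "(\<lambda>x. 0 \<le> x \<and> x \<le> pi \<and> cos x = t) = (\<lambda>x. False)"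
      using that by auto
    then show ?thesis unfolding arccos_def by simp
  qed
  have "(\<lambda>t. if t \<in> {-1..1} then arccos t else (THE x. False)) \<in> borel_measurable borel"
    by (rule borel_measurable_continuous_on_if)
       (auto intro!: continuous_intros)
  also have "(\<lambda>t. if t \<in> {-1..1} then arccos t else (THE x. False)) = arccos"
    using const by auto
  finally show ?thesis .
qed

lemma cis_measurable [measurable]: "cis \<in> borel_measurable borel"
  by (intro borel_measurable_continuous_onI continuous_intros)

lemma sets_Sz [simp]: "sets (Sz \<nu>) = sets borel"
  by (simp add: Sz_def)

lemma emeasure_Sz:
  assumes "prob_space \<nu>" and [measurable_cong]: "sets \<nu> = sets borel"
    and A [measurable]: "A \<in> sets borel"
  shows "emeasure (Sz \<nu>) A =
    (emeasure \<nu> {t. cis (arccos t) \<in> A} + emeasure \<nu> {t. cis (- arccos t) \<in> A}) / 2"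
proof -
  interpret N: prob_space \<nu> by fact
  have sp: "space \<nu> = UNIV" using assms(2) sets_eq_imp_space_eq by fastforce
  let ?U = "uniform_count_measure {-1, 1::real}"
  let ?f = "\<lambda>(s, t). cis (s * arccos t)"
  have [measurable]: "(\<lambda>s. s) \<in> borel_measurable ?U"
    by (simp add: uniform_count_measure_def)
  have [measurable]: "fst \<in> borel_measurable (?U \<Otimes>\<^sub>M \<nu>)"
    by (rule measurable_compose[OF measurable_fst, of "\<lambda>s. s"]) measurable
  have f [measurable]: "?f \<in> borel_measurable (?U \<Otimes>\<^sub>M \<nu>)"
    unfolding case_prod_beta by measurable
  have "emeasure (Sz \<nu>) A = emeasure (?U \<Otimes>\<^sub>M \<nu>) (?f -` A \<inter> space (?U \<Otimes>\<^sub>M \<nu>))"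
    unfolding Sz_def by (rule emeasure_distr[OF f A])
  also have "\<dots> = (\<integral>\<^sup>+ s. emeasure \<nu> (Pair s -` (?f -` A \<inter> space (?U \<Otimes>\<^sub>M \<nu>))) \<partial>?U)"
    by (rule N.emeasure_pair_measure_alt) measurable
  also have "\<dots> = (\<integral>\<^sup>+ s. emeasure \<nu> {t. cis (s * arccos t) \<in> A} \<partial>?U)"
    by (intro nn_integral_cong arg_cong[where f = "emeasure \<nu>"])
       (auto simp: space_pair_measure sp)
  also have "\<dots> = (\<Sum>s\<in>{-1, 1}. ennreal (1 / 2) * emeasure \<nu> {t. cis (s * arccos t) \<in> A})"
    unfolding uniform_count_measure_def
    by (subst nn_integral_point_measure_finite) auto
  also have "\<dots> = (emeasure \<nu> {t. cis (arccos t) \<in> A} + emeasure \<nu> {t. cis (- arccos t) \<in> A}) / 2"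
    by (simp add: divide_ennreal_def distrib_left mult.commute add.commute
             flip: inverse_ennreal)
  finally show ?thesis .
qed

lemma emeasure_outside_interval:
  assumes "prob_on_interval \<nu>"
  shows "emeasure \<nu> (- {-1..1}) = 0"
proof -
  have s: "sets \<nu> = sets borel" and sub: "msupport \<nu> \<subseteq> {-1..1}"
    using assms by (auto simp: prob_on_interval_def)
  define \<U> where "\<U> = {U::real set. open U \<and> emeasure \<nu> U = 0}"
  obtain \<V> where V: "\<V> \<subseteq> \<U>" "countable \<V>" "\<Union>\<V> = \<Union>\<U>"
    using Lindelof[of \<U>] by (auto simp: \<U>_def)
  have "\<Union>\<V> \<in> null_sets \<nu>"
    using V s by (intro null_sets_UN'[of \<V> "\<lambda>x. x", simplified]) (auto simp: \<U>_def null_sets_def)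
  moreover have "- {-1..1} \<subseteq> \<Union>\<V>"
    using sub unfolding V by (auto simp: msupport_def \<U>_def)
  ultimately show ?thesis
    by (metis emeasure_mono le_zero_eq null_setsD1 null_setsD2)
qed

lemma prob_space_Sz:
  assumes "prob_space \<nu>" "sets \<nu> = sets borel"
  shows "prob_space (Sz \<nu>)"
proof
  have "space \<nu> = UNIV" using assms(2) sets_eq_imp_space_eq by fastforce
  then have "emeasure \<nu> UNIV = 1" using prob_space.emeasure_space_1[OF assms(1)] by simp
  moreover have "space (Sz \<nu>) = UNIV" by (simp add: Sz_def)
  ultimately show "emeasure (Sz \<nu>) (space (Sz \<nu>)) = 1"
    by (simp add: emeasure_Sz[OF assms])
qed

lemma Sz_unit_circle:
  assumes "prob_space \<nu>" "sets \<nu> = sets borel"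
  shows "emeasure (Sz \<nu>) (- sphere 0 1) = 0"
  by (subst emeasure_Sz[OF assms]) (auto simp: borel_closed closed_sphere)

lemma Sz_cnj_invariant:
  assumes "prob_space \<nu>" "sets \<nu> = sets borel"
  shows "distr (Sz \<nu>) borel cnj = Sz \<nu>"
proof (rule measure_eqI)
  fix A :: "complex set" assume "A \<in> sets (distr (Sz \<nu>) borel cnj)"
  then have A: "A \<in> sets borel" by simp
  have c: "cnj \<in> borel_measurable borel"
    by (intro borel_measurable_continuous_onI continuous_intros)
  have B: "cnj -` A \<in> sets borel" using measurable_sets[OF c A] by simp
  have "emeasure (distr (Sz \<nu>) borel cnj) A = emeasure (Sz \<nu>) (cnj -` A)"
    using c A by (subst emeasure_distr) (auto simp: Sz_def)
  also have "\<dots> = emeasure (Sz \<nu>) A"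
    by (simp add: emeasure_Sz[OF assms A] emeasure_Sz[OF assms B] cis_cnj add.commute)
  finally show "emeasure (distr (Sz \<nu>) borel cnj) A = emeasure (Sz \<nu>) A" .
qed simp

lemma Sz_push_forward:
  assumes "prob_on_interval \<nu>"
  shows "distr (Sz \<nu>) borel Re = \<nu>"
proof (rule measure_eqI)
  have p: "prob_space \<nu>" and s [measurable_cong]: "sets \<nu> = sets borel"
    using assms by (auto simp: prob_on_interval_def)
  show "sets (distr (Sz \<nu>) borel Re) = sets \<nu>" by (simp add: s)
  fix A assume "A \<in> sets (distr (Sz \<nu>) borel Re)"
  then have A [measurable]: "A \<in> sets borel" by simp
  have B: "Re -` A \<in> sets borel"
    using measurable_sets[OF borel_measurable_Re A] by simp
  have sp: "space \<nu> = UNIV" using s sets_eq_imp_space_eq by fastforce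
  have "AE t in \<nu>. t \<in> {-1..1}"
    by (rule AE_I[where N = "- {-1..1}"])
       (auto simp: sp s emeasure_outside_interval[OF assms])
  then have ae: "AE t in \<nu>. cos (arccos t) \<in> A \<longleftrightarrow> t \<in> A"
    by eventually_elim auto
  have e: "emeasure \<nu> {t. cos (arccos t) \<in> A} = emeasure \<nu> A"
  proof (rule emeasure_eq_AE)
    show "AE t in \<nu>. t \<in> {t. cos (arccos t) \<in> A} \<longleftrightarrow> t \<in> A"
      using ae by simp
    have "{t \<in> space \<nu>. cos (arccos t) \<in> A} \<in> sets \<nu>" by measurable
    then show "{t. cos (arccos t) \<in> A} \<in> sets \<nu>" by (simp add: sp)
  qed (simp add: s)
  have "emeasure (distr (Sz \<nu>) borel Re) A = emeasure (Sz \<nu>) (Re -` A)"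
    by (subst emeasure_distr) (auto simp: Sz_def)
  also have "\<dots> = (emeasure \<nu> A + emeasure \<nu> A) / 2"
    by (simp add: emeasure_Sz[OF p s B] e)
  also have "\<dots> = emeasure \<nu> A"
    by (simp add: mult_divide_eq_ennreal flip: mult_2_right)
  finally show "emeasure (distr (Sz \<nu>) borel Re) A = emeasure \<nu> A" .
qed

section \<open>The transfer matrix and the action by fractional linear maps\<close>

definition d_tilde :: "(int \<Rightarrow> real) \<Rightarrow> nat \<Rightarrow> nat \<Rightarrow> real" where
  "d_tilde d k n = d (int n - int k)"

definition B_matrix :: "(int \<Rightarrow> real) \<Rightarrow> (int \<Rightarrow> real) \<Rightarrow> nat \<Rightarrow> complex \<Rightarrow> complex^2^2" where
  "B_matrix b d k x =
    (let P = (\<lambda>j n. poly (map_poly complex_of_real (antiassoc b d j n)) x);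
         dk = complex_of_real (d_tilde d k k)
     in vector
       [vector [dk * P (k - 1) (int k - 2), - P (k - 1) (int k - 1)],
        vector [dk * P k (int k - 1),       - P k (int k)]])"

text \<open>
  \<open>dot_eq f A g\<close> is the relation $f \doteq A g$. The fraction is required to be meaningful, since
  division by zero is total in HOL.
\<close>

definition dot_eq :: "complex \<Rightarrow> complex^2^2 \<Rightarrow> complex \<Rightarrow> bool" where
  "dot_eq f A g \<longleftrightarrow>
     A$2$1 * g + A$2$2 \<noteq> 0 \<and> f = moebius (A$1$1) (A$1$2) (A$2$1) (A$2$2) g"

end

theory Submission
  imports Defs
begin

text \<open>
  With $2x = z + z^{-1}$, the quantity $\frac{2z}{1-z^2} F(z)$ is the Stieltjes transform
  $S(x) = \int \frac{d\mu(t)}{x-t}$, and similarly for $\mu^{(-k)}$. The functions of the second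
  kind $Q_n(x) = \int \frac{P_n(t)}{x-t}\,d\mu(t)$ satisfy the three-term recurrence of the $P_n$
  from $n = 1$ on, and by Bessel's inequality they are $o(\|P_n\|)$. Comparing their growth with
  that of the Casoratian shows that $Q^{(-k)}_{n+k}$ and $Q_n$ are proportional, down to the index
  $n = -1$ where $Q_{-1}$ is read as $1/d_0$. Hence
  $Q^{(-k)}_k = d_0 S\, Q^{(-k)}_{k-1}$, and it remains to insert
  $Q^{(-k)}_n = P^{(-k)}_n S^{(-k)} - P^{(-k+1)}_{n-1}$ and to solve for $S^{(-k)}$.
\<close>

section \<open>Integration on the interval\<close>

lemma AE_prob_on_interval:
  assumes "prob_on_interval M"
  shows "AE t in M. t \<in> {-1..1}"
proof -
  have s: "sets M = sets borel" using assms by (auto simp: prob_on_interval_def)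
  have sp: "space M = UNIV" using s sets_eq_imp_space_eq by fastforce
  show ?thesis
    by (rule AE_I[where N = "- {-1..1}"])
       (auto simp: sp s emeasure_outside_interval[OF assms])
qed

text \<open>\<open>M\<close> is a measure on the whole line, where a kernel like
  \<open>1 / (x - t)\<close> may be unbounded. Since almost every point lies in the interval, a
  bound there suffices.\<close>

lemma integrable_bounded_on_interval:
  fixes f :: "real \<Rightarrow> 'b::{banach,second_countable_topology}"
  assumes M: "prob_on_interval M"
    and f: "f \<in> borel_measurable borel" and bd: "bounded (f ` {-1..1})"
  shows "integrable M f"
proof -
  have s: "sets M = sets borel" and p: "prob_space M"
    using M by (auto simp: prob_on_interval_def)
  interpret prob_space M by fact
  obtain B where B: "\<And>t. t \<in> {-1..1} \<Longrightarrow> norm (f t) \<le> B"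
    using bd unfolding bounded_iff by (metis imageI)
  have "AE t in M. norm (f t) \<le> B"
    using AE_prob_on_interval[OF M] by eventually_elim (use B in auto)
  moreover have "f \<in> borel_measurable M"
    using f measurable_cong_sets[OF s refl] by blast
  ultimately show ?thesis by (rule integrable_const_bound)
qed

lemma integrable_continuous_on_interval:
  fixes f :: "real \<Rightarrow> 'b::{banach,second_countable_topology}"
  assumes "prob_on_interval M" "f \<in> borel_measurable borel" "continuous_on {-1..1} f"
  shows "integrable M f"
  using assms by (intro integrable_bounded_on_interval compact_imp_bounded compact_continuous_image) auto

lemma borel_measurable_poly [measurable]: "poly (p :: real poly) \<in> borel_measurable borel"
  by (intro borel_measurable_continuous_onI continuous_intros)

text \<open>The left side copies the shape of the recurrence in \<open>antiassoc_aux\<close>, so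
  that the recurrence passes to values at a complex point in one rewrite.\<close>

lemma poly_of_real_pCons_mult:
  "poly (map_poly complex_of_real ([:- \<beta>, 1:] * p - smult \<delta> q)) x
    = (x - complex_of_real \<beta>) * poly (map_poly complex_of_real p) x
      - complex_of_real \<delta> * poly (map_poly complex_of_real q) x"
proof -
  have "map_poly complex_of_real ([:- \<beta>, 1:] * p - smult \<delta> q)
    = [:- complex_of_real \<beta>, 1:] * map_poly complex_of_real p
      - smult (complex_of_real \<delta>) (map_poly complex_of_real q)"
    by (rule poly_eqI) (auto simp: coeff_map_poly coeff_pCons split: nat.split)
  then show ?thesis by (simp only: poly_diff poly_mult poly_smult poly_pCons poly_0) simp
qed

section \<open>Functions of the second kind\<close>

text \<open>\<open>\<beta> n\<close> and \<open>\<delta> n\<close> are the coefficients of the step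
  from \<open>P n\<close> to \<open>P (Suc n)\<close>. The first step has its own clause, so
  \<open>\<delta>\<close> enters from index 1 on.\<close>

locale three_term_orthogonal =
  fixes M :: "real measure" and P :: "nat \<Rightarrow> real poly" and \<beta> \<delta> :: "nat \<Rightarrow> real"
  assumes M: "prob_on_interval M"
    and orth: "\<And>m n. m \<noteq> n \<Longrightarrow> (LINT t|M. poly (P m) t * poly (P n) t) = 0"
    and P_0: "P 0 = 1"
    and P_1: "P (Suc 0) = [:- \<beta> 0, 1:]"
    and P_rec: "\<And>n. P (Suc (Suc n)) = [:- \<beta> (Suc n), 1:] * P (Suc n) - smult (\<delta> (Suc n)) (P n)"
    and \<delta>_pos: "\<And>n. \<delta> (Suc n) > 0"
begin

section \<open>Squared norms of the orthogonal polynomials and Bessel's inequality\<close>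

definition h :: "nat \<Rightarrow> real" where
  "h n = (LINT t|M. (poly (P n) t)\<^sup>2)"

lemma prob: "prob_space M" and sets_M: "sets M = sets borel"
  using M by (auto simp: prob_on_interval_def)

lemma integrable_poly_mult:
  "integrable M (\<lambda>t. poly p t * poly q t)" "integrable M (\<lambda>t. t * (poly p t * poly q t))"
  by (rule integrable_continuous_on_interval[OF M], measurable, intro continuous_intros)+

lemma h_0: "h 0 = 1"
  using prob_space.prob_space[OF prob] by (simp add: h_def P_0)

text \<open>Pair the recurrence for \<open>P (Suc (Suc n))\<close> with \<open>P n\<close>:
  orthogonality kills the left side and the \<open>\<beta>\<close> term.\<close>

lemma integral_shift: "(LINT t|M. t * (poly (P (Suc n)) t * poly (P n) t)) = \<delta> (Suc n) * h n"
proof -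
  let ?I = "LINT t|M. t * (poly (P (Suc n)) t * poly (P n) t)"
  note [simp] = integrable_poly_mult
  have "0 = (LINT t|M. poly (P (Suc (Suc n))) t * poly (P n) t)"
    by (simp add: orth)
  also have "\<dots> = (LINT t|M. t * (poly (P (Suc n)) t * poly (P n) t)
      - \<beta> (Suc n) * (poly (P (Suc n)) t * poly (P n) t) - \<delta> (Suc n) * (poly (P n) t * poly (P n) t))"
    by (intro Bochner_Integration.integral_cong) (auto simp: P_rec algebra_simps)
  also have "\<dots> = ?I - \<delta> (Suc n) * h n"
    by (simp add: orth h_def power2_eq_square)
  finally show ?thesis by simp
qed

text \<open>Expanding one factor of the square by the recurrence leaves only the integral of
  \<open>integral_shift\<close>. Iterated from \<open>h 0 = 1\<close>, this makes \<open>h n\<close>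
  the product of \<open>\<delta> 1\<close> up to \<open>\<delta> n\<close>.\<close>

lemma h_Suc: "h (Suc n) = \<delta> (Suc n) * h n"
proof -
  let ?I = "LINT t|M. t * (poly (P (Suc n)) t * poly (P n) t)"
  note [simp] = integrable_poly_mult
  have "h (Suc n) = ?I"
  proof (cases n)
    case 0
    have "h (Suc n) = (LINT t|M. t * (poly (P (Suc 0)) t * poly (P 0) t)
      - \<beta> 0 * (poly (P (Suc 0)) t * poly (P 0) t))"
      unfolding h_def by (intro Bochner_Integration.integral_cong)
        (auto simp: P_0 P_1 0 algebra_simps power2_eq_square)
    also have "\<dots> = ?I" by (simp add: orth 0)
    finally show ?thesis .
  next
    case (Suc m)
    have "h (Suc n) = (LINT t|M. t * (poly (P (Suc n)) t * poly (P n) t)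
      - \<beta> n * (poly (P (Suc n)) t * poly (P n) t) - \<delta> n * (poly (P (Suc n)) t * poly (P m) t))"
      unfolding h_def by (intro Bochner_Integration.integral_cong refl)
        (simp add: Suc P_rec[of m] algebra_simps power2_eq_square)
    also have "\<dots> = ?I" by (simp add: orth Suc)
    finally show ?thesis .
  qed
  then show ?thesis by (simp add: integral_shift)
qed

lemma h_pos: "h n > 0"
  by (induction n) (auto simp: h_0 h_Suc \<delta>_pos)

text \<open>Let \<open>g N\<close> be \<open>f\<close> minus its projection onto the first
  \<open>N\<close> polynomials. Each further projection lowers the squared norm by
  \<open>(c N)\<^sup>2 * h N\<close>, and the norm of the residual stays nonnegative.\<close>

lemma bessel:
  assumes f [measurable]: "f \<in> borel_measurable borel" and cf: "continuous_on {-1..1} f"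
  shows "(\<Sum>n<N. (LINT t|M. f t * poly (P n) t)\<^sup>2 / h n) \<le> (LINT t|M. (f t)\<^sup>2)"
proof -
  define c where "c n = (LINT t|M. f t * poly (P n) t) / h n" for n
  define g where "g N t = f t - (\<Sum>n<N. c n * poly (P n) t)" for N t
  have [measurable]: "g N \<in> borel_measurable borel" for N
    unfolding g_def by measurable
  have cg: "continuous_on {-1..1} (g N)" for N
    unfolding g_def using cf by (intro continuous_intros) auto
  have [simp]: "integrable M (\<lambda>t. f t * poly p t)" for p
    by (rule integrable_continuous_on_interval[OF M], measurable) (intro continuous_intros cf)
  have [simp]: "integrable M (\<lambda>t. g N t * poly p t)" for N p
    by (rule integrable_continuous_on_interval[OF M], measurable) (intro continuous_intros cg)
  have [simp]: "integrable M (\<lambda>t. (g N t)\<^sup>2)" for N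
    by (rule integrable_continuous_on_interval[OF M], measurable) (intro continuous_intros cg)
  have [simp]: "integrable M (\<lambda>t. (poly p t)\<^sup>2)" for p
    using integrable_poly_mult(1)[of p p] by (simp add: power2_eq_square)
  \<comment> \<open>Coefficients of index \<open>N\<close> or more are not changed by the
    subtraction, so at stage \<open>N\<close> the residual still has the coefficient
    \<open>c N\<close> of \<open>f\<close>.\<close>
  have gP: "(LINT t|M. g N t * poly (P m) t) = (LINT t|M. f t * poly (P m) t)" if "N \<le> m" for N m
  proof -
    have "(LINT t|M. g N t * poly (P m) t)
      = (LINT t|M. f t * poly (P m) t - (\<Sum>n<N. c n * (poly (P n) t * poly (P m) t)))"
      by (intro Bochner_Integration.integral_cong)
         (auto simp: g_def algebra_simps sum_distrib_left)
    also have "\<dots> = (LINT t|M. f t * poly (P m) t)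
        - (\<Sum>n<N. c n * (LINT t|M. poly (P n) t * poly (P m) t))"
      by (simp add: integrable_poly_mult)
    also have "(\<Sum>n<N. c n * (LINT t|M. poly (P n) t * poly (P m) t)) = 0"
      using that by (intro sum.neutral) (auto simp: orth)
    finally show ?thesis by simp
  qed
  have "(LINT t|M. (g N t)\<^sup>2) = (LINT t|M. (f t)\<^sup>2) - (\<Sum>n<N. (c n)\<^sup>2 * h n)"
  proof (induction N)
    case 0
    then show ?case by (simp add: g_def)
  next
    case (Suc N)
    have "(LINT t|M. (g (Suc N) t)\<^sup>2) = (LINT t|M. (g N t)\<^sup>2
        - 2 * c N * (g N t * poly (P N) t) + (c N)\<^sup>2 * (poly (P N) t)\<^sup>2)"
      by (intro Bochner_Integration.integral_cong)
         (auto simp: g_def algebra_simps power2_eq_square)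
    also have "\<dots> = (LINT t|M. (g N t)\<^sup>2) - 2 * c N * (LINT t|M. g N t * poly (P N) t) + (c N)\<^sup>2 * h N"
      by (simp add: h_def)
    also have "(LINT t|M. g N t * poly (P N) t) = c N * h N"
      using h_pos[of N] by (simp add: gP c_def)
    finally show ?case using Suc by (simp add: power2_eq_square)
  qed
  moreover have "(LINT t|M. (g N t)\<^sup>2) \<ge> 0" by simp
  moreover have "(c n)\<^sup>2 * h n = (LINT t|M. f t * poly (P n) t)\<^sup>2 / h n" for n
    using h_pos[of n] by (simp add: c_def power2_eq_square)
  ultimately show ?thesis by simp
qed

lemma coefficient_tendsto_0:
  assumes "f \<in> borel_measurable borel" "continuous_on {-1..1} f"
  shows "(\<lambda>n. (LINT t|M. f t * poly (P n) t) / sqrt (h n)) \<longlonglongrightarrow> 0"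
proof -
  have "summable (\<lambda>n. (LINT t|M. f t * poly (P n) t)\<^sup>2 / h n)"
    by (rule summableI_nonneg_bounded[where x = "LINT t|M. (f t)\<^sup>2"])
       (use bessel[OF assms] h_pos in \<open>auto simp: less_imp_le\<close>)
  then have "(\<lambda>n. sqrt ((LINT t|M. f t * poly (P n) t)\<^sup>2 / h n)) \<longlonglongrightarrow> sqrt 0"
    by (intro tendsto_real_sqrt summable_LIMSEQ_zero)
  then have "(\<lambda>n. \<bar>(LINT t|M. f t * poly (P n) t) / sqrt (h n)\<bar>) \<longlonglongrightarrow> 0"
    using h_pos by (simp add: real_sqrt_divide abs_of_pos)
  then show ?thesis by (rule tendsto_rabs_zero_cancel)
qed

section \<open>Recurrence and decay of the functions of the second kind\<close>

definition Q :: "complex \<Rightarrow> nat \<Rightarrow> complex" where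
  "Q x n = (LINT t|M. of_real (poly (P n) t) / (x - of_real t))"

context
  fixes x :: complex
  assumes x: "x \<notin> of_real ` {-1..1}"
begin

lemma x_neq: "t \<in> {-1..1} \<Longrightarrow> x - of_real t \<noteq> 0"
  using x by auto

lemma integrable_poly_divide [simp]: "integrable M (\<lambda>t. of_real (poly p t) / (x - of_real t))"
  by (rule integrable_continuous_on_interval[OF M], measurable)
     (intro continuous_intros, use x_neq in auto)

text \<open>Write \<open>t - b\<close> as \<open>(x - b) - (x - t)\<close>; the second term cancels
  the denominator and leaves the plain integral of \<open>p\<close>. That integral is 1 for
  \<open>P 0\<close>, which gives \<open>Q_1\<close>, and 0 for \<open>P (Suc n)\<close>, which
  gives \<open>Q_rec\<close>.\<close>

lemma integral_poly_recurrence: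
  "(LINT t|M. of_real (poly ([:- b, 1:] * p - smult d q) t) / (x - of_real t))
     = (x - of_real b) * (LINT t|M. of_real (poly p t) / (x - of_real t))
       - of_real d * (LINT t|M. of_real (poly q t) / (x - of_real t)) - of_real (LINT t|M. poly p t)"
proof -
  note [measurable_cong] = sets_M
  have ip: "integrable M (poly p)"
    by (rule integrable_continuous_on_interval[OF M], measurable) (intro continuous_intros)
  have "(LINT t|M. of_real (poly ([:- b, 1:] * p - smult d q) t) / (x - of_real t))
    = (LINT t|M. (x - of_real b) * (of_real (poly p t) / (x - of_real t))
        - of_real d * (of_real (poly q t) / (x - of_real t)) - of_real (poly p t))"
  \<comment> \<open>The cancellation fails at \<open>t = x\<close>, which can occur when
    \<open>x\<close> is real; such a \<open>t\<close> lies outside the interval.\<close>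
  proof (rule integral_cong_AE)
    show "AE t in M. of_real (poly ([:- b, 1:] * p - smult d q) t) / (x - of_real t)
      = (x - of_real b) * (of_real (poly p t) / (x - of_real t))
        - of_real d * (of_real (poly q t) / (x - of_real t)) - of_real (poly p t)"
      using AE_prob_on_interval[OF M]
    proof eventually_elim
      case (elim t)
      then show ?case using x_neq[of t] by (simp add: divide_simps) (simp add: algebra_simps)
    qed
  qed measurable
  also have "\<dots> = (x - of_real b) * (LINT t|M. of_real (poly p t) / (x - of_real t))
       - of_real d * (LINT t|M. of_real (poly q t) / (x - of_real t)) - of_real (LINT t|M. poly p t)"
    using ip by (simp add: integral_of_real del: times_divide_eq_right)
  finally show ?thesis .
qed

lemma Q_1: "Q x (Suc 0) = (x - of_real (\<beta> 0)) * Q x 0 - 1"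
  using integral_poly_recurrence[of "\<beta> 0" "P 0" 0 0] prob_space.prob_space[OF prob]
  by (simp add: Q_def P_0 P_1)

lemma Q_rec: "Q x (Suc (Suc n)) = (x - of_real (\<beta> (Suc n))) * Q x (Suc n) - of_real (\<delta> (Suc n)) * Q x n"
  using integral_poly_recurrence[of "\<beta> (Suc n)" "P (Suc n)" "\<delta> (Suc n)" "P n"] orth[of "Suc n" 0]
  unfolding Q_def P_rec by (simp add: P_0)

text \<open>The real and imaginary parts of the Cauchy kernel are continuous on the interval, and
  the quotients are made of their normalised Fourier coefficients.\<close>

lemma Q_tendsto_0: "(\<lambda>n. Q x n / of_real (sqrt (h n))) \<longlonglongrightarrow> 0"
proof -
  have c: "continuous_on {-1..1} (\<lambda>t. 1 / (x - complex_of_real t))"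
    by (intro continuous_intros) (use x_neq in auto)
  have Re: "Re (Q x n) = (LINT t|M. Re (1 / (x - of_real t)) * poly (P n) t)" for n
    unfolding Q_def
    by (subst integral_Re[symmetric]) (auto intro!: Bochner_Integration.integral_cong simp: Re_divide)
  have Im: "Im (Q x n) = (LINT t|M. Im (1 / (x - of_real t)) * poly (P n) t)" for n
    unfolding Q_def
    by (subst integral_Im[symmetric]) (auto intro!: Bochner_Integration.integral_cong simp: Im_divide)
  have "(\<lambda>n. Re (Q x n) / sqrt (h n)) \<longlonglongrightarrow> 0" unfolding Re
    by (intro coefficient_tendsto_0 continuous_on_Re c) measurable
  moreover have "(\<lambda>n. Im (Q x n) / sqrt (h n)) \<longlonglongrightarrow> 0" unfolding Im
    by (intro coefficient_tendsto_0 continuous_on_Im c) measurable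
  ultimately show ?thesis
    by (subst tendsto_complex_iff) simp
qed

end

text \<open>On the interval \<open>\<bar>t\<bar> \<le> 1\<close>, so the integral in
  \<open>integral_shift\<close> is at most the mean of the two squared norms. In other words,
  \<open>\<delta> (Suc n) \<le> 1\<close>.\<close>

lemma h_Suc_le: "h (Suc n) \<le> h n"
proof -
  let ?u = "poly (P (Suc n))" and ?v = "poly (P n)"
  have [simp]: "integrable M (\<lambda>t. (poly p t)\<^sup>2)" for p
    using integrable_poly_mult(1)[of p p] by (simp add: power2_eq_square)
  have "h (Suc n) = (LINT t|M. t * (?u t * ?v t))"
    by (simp add: h_Suc integral_shift)
  also have "\<dots> \<le> (LINT t|M. ((?u t)\<^sup>2 + (?v t)\<^sup>2) / 2)"
  proof (rule integral_mono_AE)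
    show "AE t in M. t * (?u t * ?v t) \<le> ((?u t)\<^sup>2 + (?v t)\<^sup>2) / 2"
      using AE_prob_on_interval[OF M]
    proof eventually_elim
      case (elim t)
      have "t * (?u t * ?v t) \<le> \<bar>t\<bar> * \<bar>?u t * ?v t\<bar>"
        by (metis abs_ge_self abs_mult)
      also have "\<dots> \<le> 1 * \<bar>?u t * ?v t\<bar>"
        using elim by (intro mult_right_mono) auto
      also have "\<dots> \<le> ((?u t)\<^sup>2 + (?v t)\<^sup>2) / 2"
        using sum_squares_bound[of "\<bar>?u t\<bar>" "\<bar>?v t\<bar>"] by (simp add: abs_mult)
      finally show ?case .
    qed
  qed (simp_all add: integrable_poly_mult)
  also have "\<dots> = (h (Suc n) + h n) / 2"
    by (simp add: h_def)
  finally show ?thesis by simp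
qed

end

section \<open>The Szeg\H{o} transformation and the Stieltjes transform\<close>

text \<open>With \<open>w\<close> and its conjugate \<open>v\<close> on the unit circle over
  \<open>t\<close>, the product \<open>(w - z) * (v - z)\<close> equals \<open>2 * z\<close> times
  \<open>x - t\<close>, where \<open>x = (z + inverse z) / 2\<close>, and the numerators add up to
  \<open>2 * (1 - z\<^sup>2)\<close>. As \<open>z\<close> is inside the disc, neither factor
  vanishes, which keeps \<open>x\<close> off the interval.\<close>

lemma joukowski_kernel:
  fixes z :: complex
  assumes z: "0 < norm z" "norm z < 1" and t: "t \<in> {-1..1}"
  shows "2 * z / (1 - z\<^sup>2) *
      (((cis (- arccos t) + z) / (cis (- arccos t) - z) + (cis (arccos t) + z) / (cis (arccos t) - z)) / 2)
    = 1 / ((z + inverse z) / 2 - of_real t)"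
    and "(z + inverse z) / 2 \<noteq> of_real t"
proof -
  define w v where "w = cis (arccos t)" and "v = cis (- arccos t)"
  have wv: "w * v = 1" by (simp add: w_def v_def cis_mult)
  have sum: "w + v = 2 * of_real t"
    using t by (simp add: w_def v_def complex_eq_iff)
  have nz: "w - z \<noteq> 0" "v - z \<noteq> 0"
    using z by (auto simp: w_def v_def)
  have z0: "z \<noteq> 0" using z by auto
  have z1: "1 - z\<^sup>2 \<noteq> 0"
  proof
    assume "1 - z\<^sup>2 = 0"
    then have "norm z ^ 2 = 1" by (metis eq_iff_diff_eq_0 norm_one norm_power)
    then show False using z by (simp add: power2_eq_1_iff)
  qed
  have prod: "(w - z) * (v - z) = 2 * z * ((z + inverse z) / 2 - of_real t)"
  proof -
    have "(w - z) * (v - z) = w * v - z * (w + v) + z * z" by (simp add: algebra_simps)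
    also have "\<dots> = 2 * z * ((z + inverse z) / 2 - of_real t)"
      unfolding wv sum using z0 by (simp add: field_simps)
    finally show ?thesis .
  qed
  then show ne: "(z + inverse z) / 2 \<noteq> of_real t"
    using nz by auto
  have num: "(v + z) * (w - z) + (w + z) * (v - z) = 2 * (1 - z\<^sup>2)"
  proof -
    have "(v + z) * (w - z) + (w + z) * (v - z) = 2 * (w * v) - 2 * z\<^sup>2"
      by (simp add: algebra_simps power2_eq_square)
    then show ?thesis by (simp add: wv)
  qed
  have "(v + z) / (v - z) + (w + z) / (w - z) = 2 * (1 - z\<^sup>2) / ((w - z) * (v - z))"
    using nz by (simp add: add_frac_eq num mult.commute[of "v - z"])
  also have "\<dots> = (1 - z\<^sup>2) / (z * ((z + inverse z) / 2 - of_real t))"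
    unfolding prod mult.assoc by (rule mult_divide_mult_cancel_left) simp
  finally show "2 * z / (1 - z\<^sup>2) *
      (((cis (- arccos t) + z) / (cis (- arccos t) - z) + (cis (arccos t) + z) / (cis (arccos t) - z)) / 2)
    = 1 / ((z + inverse z) / 2 - of_real t)"
    using z0 z1 unfolding w_def v_def by simp
qed

lemma norm_C_kernel_le:
  fixes z :: complex
  assumes "norm w = 1" "norm z < 1"
  shows "norm ((w + z) / (w - z)) \<le> 2 / (1 - norm z)"
proof -
  have "norm (w + z) \<le> 2" using norm_triangle_ineq[of w z] assms by simp
  moreover have "1 - norm z \<le> norm (w - z)" using norm_triangle_ineq2[of w z] assms by simp
  ultimately show ?thesis using assms unfolding norm_divide
    by (intro frac_le) auto
qed

text \<open>Fubini over the random sign. \<open>B\<close> bounds \<open>g\<close> on the unit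
  circle, where all values of \<open>cis\<close> lie, and so yields integrability on the product
  space.\<close>

lemma integral_Sz:
  fixes g :: "complex \<Rightarrow> complex"
  assumes M: "prob_on_interval M"
    and g [measurable]: "g \<in> borel_measurable borel"
    and bd: "\<And>w. norm w = 1 \<Longrightarrow> norm (g w) \<le> B"
  shows "(LINT w|Sz M. g w) = (LINT t|M. (g (cis (- arccos t)) + g (cis (arccos t))) / 2)"
proof -
  have s [measurable_cong]: "sets M = sets borel" and p: "prob_space M"
    using M by (auto simp: prob_on_interval_def)
  have int: "integrable M (\<lambda>t. g (cis (s * arccos t)))" for s
  proof (rule finite_measure.integrable_const_bound[where B = B])
    show "finite_measure M" using p by (rule prob_space.finite_measure)
    show "(\<lambda>t. g (cis (s * arccos t))) \<in> borel_measurable M" by measurable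
  qed (auto intro!: AE_I2 bd)
  let ?U = "uniform_count_measure {-1, 1::real}"
  have pU: "prob_space ?U" by (rule prob_space_uniform_count_measure) auto
  interpret pair_prob_space ?U M
    using p pU by (simp add: pair_prob_space_def pair_sigma_finite_def prob_space_imp_sigma_finite)
  have [measurable]: "(\<lambda>s. s) \<in> borel_measurable ?U"
    by (simp add: uniform_count_measure_def)
  have [measurable]: "fst \<in> borel_measurable (?U \<Otimes>\<^sub>M M)"
    by (rule measurable_compose[OF measurable_fst, of "\<lambda>s. s"]) measurable
  have f [measurable]: "(\<lambda>p. cis (fst p * arccos (snd p))) \<in> borel_measurable (?U \<Otimes>\<^sub>M M)"
    by measurable
  have "(LINT w|Sz M. g w) = (LINT p|(?U \<Otimes>\<^sub>M M). g (cis (fst p * arccos (snd p))))"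
    unfolding Sz_def case_prod_beta by (rule integral_distr[OF f g])
  also have "\<dots> = (LINT s|?U. LINT t|M. g (cis (fst (s, t) * arccos (snd (s, t)))))"
  proof (rule integral_fst'[symmetric])
    show "integrable (?U \<Otimes>\<^sub>M M) (\<lambda>p. g (cis (fst p * arccos (snd p))))"
      by (rule P.integrable_const_bound[where B = B]) (auto intro!: AE_I2 bd)
  qed
  also have "\<dots> = (LINT s|?U. LINT t|M. g (cis (s * arccos t)))"
    by simp
  also have "\<dots> = (\<Sum>s\<in>{-1, 1}. (1 / 2) *\<^sub>R (LINT t|M. g (cis (s * arccos t))))"
    unfolding uniform_count_measure_def
    by (subst lebesgue_integral_point_measure_finite) auto
  also have "\<dots> = (LINT t|M. (g (cis (- arccos t)) + g (cis (arccos t))) / 2)"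
    using int[of "-1"] int[of 1] by (simp add: scaleR_conv_of_real add_divide_distrib)
  finally show ?thesis .
qed

lemma C_function_Sz:
  fixes z :: complex
  assumes M: "prob_on_interval M" and z: "0 < norm z" "norm z < 1"
  shows "2 * z / (1 - z\<^sup>2) * C_function (Sz M) z = (LINT t|M. 1 / ((z + inverse z) / 2 - of_real t))"
proof -
  have [measurable_cong]: "sets M = sets borel"
    using M by (auto simp: prob_on_interval_def)
  let ?g = "\<lambda>w. (w + z) / (w - z)"
  have "C_function (Sz M) z = (LINT t|M. (?g (cis (- arccos t)) + ?g (cis (arccos t))) / 2)"
    unfolding C_function_def
    by (rule integral_Sz[OF M, where B = "2 / (1 - norm z)"]) (measurable, use norm_C_kernel_le z in blast)
  then have "2 * z / (1 - z\<^sup>2) * C_function (Sz M) z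
    = (LINT t|M. 2 * z / (1 - z\<^sup>2) * ((?g (cis (- arccos t)) + ?g (cis (arccos t))) / 2))"
    by (simp only: integral_mult_right_zero)
  also have "\<dots> = (LINT t|M. 1 / ((z + inverse z) / 2 - of_real t))"
  \<comment> \<open>The kernel identity holds for \<open>t\<close> in the interval, where
    \<open>cos (arccos t) = t\<close>.\<close>
  proof (rule integral_cong_AE)
    show "AE t in M. 2 * z / (1 - z\<^sup>2) * ((?g (cis (- arccos t)) + ?g (cis (arccos t))) / 2)
      = 1 / ((z + inverse z) / 2 - of_real t)"
      using AE_prob_on_interval[OF M] by eventually_elim (rule joukowski_kernel(1)[OF z])
  qed measurable
  finally show ?thesis .
qed

text \<open>Both sides obey the same recurrence. \<open>R\<close> is the sequence of numerator
  polynomials at \<open>x\<close>, shifted so that \<open>R n\<close> comes from degree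
  \<open>n - 1\<close>; \<open>R (Suc 0) = 1\<close> accounts for the \<open>- 1\<close> in
  \<open>Q_1\<close>.\<close>

lemma (in three_term_orthogonal) Q_eq_numerator:
  assumes x: "x \<notin> of_real ` {-1..1}" and "R 0 = 0" "R (Suc 0) = 1"
    and "\<And>n. R (Suc (Suc n)) = (x - of_real (\<beta> (Suc n))) * R (Suc n) - of_real (\<delta> (Suc n)) * R n"
  shows "Q x n = poly (map_poly complex_of_real (P n)) x * Q x 0 - R n"
proof (induction n rule: induct_nat_012)
  case 1
  then show ?case using assms by (simp add: Q_1[OF x] P_1 map_poly_pCons)
next
  case (ge2 n)
  then show ?case
    unfolding Q_rec[OF x] P_rec poly_of_real_pCons_mult assms(4)
    by (simp only:) (simp add: algebra_simps)
qed (use assms in \<open>simp add: P_0\<close>)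

section \<open>Comparison of the two families\<close>

text \<open>The \<open>\<beta>\<close> terms cancel, so each step multiplies the Casoratian by
  \<open>\<delta> n\<close>. Here \<open>\<beta> n\<close> and \<open>\<delta> n\<close> belong to
  the step that produces index \<open>n + 2\<close>.\<close>

lemma casoratian_three_term:
  fixes u v \<beta> \<delta> :: "nat \<Rightarrow> 'a::comm_ring_1"
  assumes u: "\<And>n. u (Suc (Suc n)) = \<beta> n * u (Suc n) - \<delta> n * u n"
    and v: "\<And>n. v (Suc (Suc n)) = \<beta> n * v (Suc n) - \<delta> n * v n"
  shows "u (Suc n) * v n - u n * v (Suc n) = (\<Prod>i<n. \<delta> i) * (u 1 * v 0 - u 0 * v 1)"
proof (induction n)
  case (Suc n)
  have "u (Suc (Suc n)) * v (Suc n) - u (Suc n) * v (Suc (Suc n))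
    = \<delta> n * (u (Suc n) * v n - u n * v (Suc n))"
    by (simp add: u v algebra_simps)
  also note Suc.IH
  finally show ?case by (simp add: mult_ac)
qed simp

lemma antiassoc_three_term:
  assumes M: "prob_on_interval M" "monic_orthogonal M (\<lambda>n. antiassoc b d j (int n))"
    and d: "\<And>i. i \<ge> 1 - int j \<Longrightarrow> d i > 0"
  shows "three_term_orthogonal M (\<lambda>n. antiassoc_aux b d j (Suc n))
    (\<lambda>n. b (int n + 1 - int j)) (\<lambda>n. d (int n - int j))"
proof -
  have "antiassoc b d j (int n) = antiassoc_aux b d j (Suc n)" for n
    by (simp add: antiassoc_def nat_add_distrib)
  with M d show ?thesis
    by unfold_locales (auto simp: monic_orthogonal_def algebra_simps)
qed

text \<open>From index \<open>Suc m\<close> on, the primed coefficients are the unprimed ones, so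
  both second-kind sequences solve one recurrence. Their Casoratian \<open>W n\<close> is
  \<open>A.h n * W 0\<close>, while decay makes it \<open>o(A.h n)\<close>; hence
  \<open>W 0 = 0\<close>.\<close>

lemma Q_shift_proportional:
  assumes A: "three_term_orthogonal M P \<beta> \<delta>" and K: "three_term_orthogonal M' P' \<beta>' \<delta>'"
    and \<beta>: "\<And>n. \<beta>' (n + Suc m) = \<beta> n" and \<delta>: "\<And>n. \<delta>' (Suc n + Suc m) = \<delta> (Suc n)"
    and x: "x \<notin> of_real ` {-1..1}"
  shows "three_term_orthogonal.Q M' P' x (Suc m)
    = of_real (\<delta>' (Suc m)) * three_term_orthogonal.Q M P x 0 * three_term_orthogonal.Q M' P' x m"
proof -
  interpret A: three_term_orthogonal M P \<beta> \<delta> by fact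
  interpret K: three_term_orthogonal M' P' \<beta>' \<delta>' by fact
  define q y where "q = A.Q x" and "y n = K.Q x (n + Suc m)" for n
  define W where "W n = y (Suc n) * q n - y n * q (Suc n)" for n
  have q_rec: "q (Suc (Suc n)) = (x - of_real (\<beta> (Suc n))) * q (Suc n) - of_real (\<delta> (Suc n)) * q n" for n
    unfolding q_def by (rule A.Q_rec[OF x])
  have y_rec: "y (Suc (Suc n)) = (x - of_real (\<beta> (Suc n))) * y (Suc n) - of_real (\<delta> (Suc n)) * y n" for n
    using K.Q_rec[OF x, of "n + Suc m"] \<beta>[of "Suc n"] \<delta>[of n] by (simp add: y_def)
  have "W (Suc n) = of_real (\<delta> (Suc n)) * W n" for n
    unfolding W_def by (simp add: q_rec y_rec algebra_simps)
  then have W: "W n = of_real (A.h n) * W 0" for n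
    by (induction n) (auto simp: A.h_0 A.h_Suc)
  \<comment> \<open>The two families of squared norms differ by a constant factor, so both decay
    statements can be measured against \<open>A.h\<close>.\<close>
  have Kh: "K.h (n + Suc m) = K.h (Suc m) * A.h n" for n
  proof (induction n)
    case (Suc n)
    then show ?case using K.h_Suc[of "n + Suc m"] \<delta>[of n] by (simp add: A.h_Suc)
  qed (simp add: A.h_0)
  define e E where "e = (\<lambda>n. norm (q n) / sqrt (A.h n))" and "E = (\<lambda>n. norm (K.Q x n) / sqrt (K.h n))"
  have e: "e \<longlonglongrightarrow> 0"
    using tendsto_norm_zero[OF A.Q_tendsto_0[OF x]] A.h_pos
    by (simp add: e_def q_def norm_divide abs_of_pos)
  have E: "E \<longlonglongrightarrow> 0"
    using tendsto_norm_zero[OF K.Q_tendsto_0[OF x]] K.h_pos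
    by (simp add: E_def norm_divide abs_of_pos)
  have q_e: "norm (q n) = sqrt (A.h n) * e n" for n
    using A.h_pos[of n] by (simp add: e_def)
  have y_E: "norm (y n) = sqrt (K.h (Suc m)) * sqrt (A.h n) * E (n + Suc m)" for n
    using K.h_pos[of "n + Suc m"] Kh[of n] A.h_pos[of n] K.h_pos[of "Suc m"]
    by (simp add: E_def y_def real_sqrt_mult)
  have e_nonneg: "e n \<ge> 0" and E_nonneg: "E n \<ge> 0" for n
    using A.h_pos[of n] K.h_pos[of n] by (auto simp: e_def E_def)
  have bound: "norm (W 0) \<le> sqrt (K.h (Suc m)) *
      (E (Suc n + Suc m) * e n + E (n + Suc m) * e (Suc n))" for n
  proof -
    let ?c = "sqrt (K.h (Suc m))" and ?s = "sqrt (A.h n)" and ?s' = "sqrt (A.h (Suc n))"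
    \<comment> \<open>Monotonicity of \<open>A.h\<close> turns the mixed factor from two
      neighbouring indices into \<open>A.h n\<close>, which then cancels.\<close>
    have ss: "?s' * ?s \<le> A.h n"
      using mult_right_mono[OF real_sqrt_le_mono[OF A.h_Suc_le[of n]], of ?s] A.h_pos[of n] by simp
    have "A.h n * norm (W 0) = norm (W n)"
      using A.h_pos[of n] by (simp add: W[of n] norm_mult)
    also have "\<dots> \<le> norm (y (Suc n)) * norm (q n) + norm (y n) * norm (q (Suc n))"
      unfolding W_def by (metis norm_mult norm_triangle_ineq4)
    also have "\<dots> = (?s' * ?s) * (?c * (E (Suc n + Suc m) * e n + E (n + Suc m) * e (Suc n)))"
      unfolding q_e y_E by (simp add: algebra_simps)
    also have "\<dots> \<le> A.h n * (?c * (E (Suc n + Suc m) * e n + E (n + Suc m) * e (Suc n)))"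
      using K.h_pos[of "Suc m"]
      by (intro mult_right_mono ss mult_nonneg_nonneg add_nonneg_nonneg e_nonneg E_nonneg) simp
    finally show ?thesis using A.h_pos[of n] by simp
  qed
  have "(\<lambda>n. sqrt (K.h (Suc m)) * (E (Suc n + Suc m) * e n + E (n + Suc m) * e (Suc n)))
      \<longlonglongrightarrow> sqrt (K.h (Suc m)) * (0 * 0 + 0 * 0)"
    using LIMSEQ_ignore_initial_segment[OF E, of "Suc (Suc m)"] LIMSEQ_ignore_initial_segment[OF E, of "Suc m"]
    by (intro tendsto_intros e LIMSEQ_Suc) simp_all
  then have "norm (W 0) \<le> sqrt (K.h (Suc m)) * (0 * 0 + 0 * 0)"
    by (rule LIMSEQ_le_const) (use bound in blast)
  then have "W 0 = 0" by simp
  \<comment> \<open>One step of the primed recurrence below the common range: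
    \<open>\<delta>' (Suc m) * K.Q x m\<close> stands opposite the 1 in \<open>A.Q_1\<close>, so
    \<open>W 0 = 0\<close> becomes the claim.\<close>
  moreover have "y (Suc 0) = (x - of_real (\<beta> 0)) * y 0 - of_real (\<delta>' (Suc m)) * K.Q x m"
    using K.Q_rec[OF x, of m] \<beta>[of 0] by (simp add: y_def)
  ultimately have "y 0 = of_real (\<delta>' (Suc m)) * q 0 * K.Q x m"
    unfolding W_def by (simp add: q_def A.Q_1[OF x] algebra_simps)
  then show ?thesis by (simp add: y_def q_def)
qed

section \<open>The fractional linear relation between the two transforms\<close>

theorem theorem4:
  fixes \<mu> \<mu>k :: "real measure" and b d :: "int \<Rightarrow> real" and k :: nat and z :: complex
  assumes mu: "prob_on_interval \<mu>" "nontrivial_measure \<mu>"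
    and orth: "monic_orthogonal \<mu> (\<lambda>n. antiassoc b d 0 (int n))"
    and d_pos: "\<And>i. i \<ge> 1 \<Longrightarrow> d i > 0"
    and k: "k \<ge> 1"
    and d_new_pos: "\<And>i. 1 - int k \<le> i \<Longrightarrow> i \<le> 0 \<Longrightarrow> d i > 0"
    and muk: "prob_on_interval \<mu>k"
    and orthk: "monic_orthogonal \<mu>k (\<lambda>n. antiassoc b d k (int n))"
    and z: "0 < norm z" "norm z < 1"
  shows "dot_eq (2 * z / (1 - z^2) * C_function (Sz \<mu>k) z)
           (B_matrix b d k ((z + inverse z) / 2))
           (2 * z / (1 - z^2) * C_function (Sz \<mu>) z)"
proof -
  obtain m where m: "k = Suc m" using k by (cases k) auto
  define x where "x = (z + inverse z) / 2"
  have x: "x \<notin> of_real ` {-1..1}"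
    using joukowski_kernel(2)[OF z] unfolding x_def by blast
  have d: "d i > 0" if "i \<ge> 1 - int k" for i
    using d_pos[of i] d_new_pos[of i] that by linarith
  interpret A: three_term_orthogonal \<mu> "\<lambda>n. antiassoc_aux b d 0 (Suc n)"
      "\<lambda>n. b (int n + 1 - int 0)" "\<lambda>n. d (int n - int 0)"
    by (rule antiassoc_three_term) (use mu orth d_pos in auto)
  interpret K: three_term_orthogonal \<mu>k "\<lambda>n. antiassoc_aux b d k (Suc n)"
      "\<lambda>n. b (int n + 1 - int k)" "\<lambda>n. d (int n - int k)"
    by (rule antiassoc_three_term) (use muk orthk d in auto)
  define S S' where "S = A.Q x 0" and "S' = K.Q x 0"
  have F: "2 * z / (1 - z^2) * C_function (Sz \<mu>) z = S"
    "2 * z / (1 - z^2) * C_function (Sz \<mu>k) z = S'"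
    using C_function_Sz[OF mu(1) z] C_function_Sz[OF muk z]
    by (simp_all add: S_def S'_def A.Q_def K.Q_def x_def)
  \<comment> \<open>\<open>p n\<close> is the order-\<open>k\<close> polynomial of degree
    \<open>n\<close> at \<open>x\<close>. In \<open>r\<close> the index of
    \<open>antiassoc_aux\<close> is not raised, so \<open>r n\<close> is the order-\<open>m\<close>
    polynomial of index \<open>n - 1\<close>.\<close>
  define p r where "p n = poly (map_poly complex_of_real (antiassoc_aux b d k (Suc n))) x"
    and "r n = poly (map_poly complex_of_real (antiassoc_aux b d m n)) x" for n
  have p0: "p 0 = 1" by (simp add: p_def)
  have r0: "r 0 = 0" "r (Suc 0) = 1" by (simp_all add: r_def)
  have p_rec: "p (Suc (Suc n)) = (x - of_real (b (int (Suc n) + 1 - int k))) * p (Suc n)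
      - of_real (d (int (Suc n) - int k)) * p n" for n
    unfolding p_def antiassoc_aux.simps(3)[of _ _ _ "Suc n"] by (rule poly_of_real_pCons_mult)
  \<comment> \<open>Lowering the degree index and the order by one together leaves the coefficient
    indices unchanged, so \<open>r\<close> solves the recurrence of \<open>p\<close>.\<close>
  have r_rec: "r (Suc (Suc n)) = (x - of_real (b (int (Suc n) + 1 - int k))) * r (Suc n)
      - of_real (d (int (Suc n) - int k)) * r n" for n
  proof -
    have "int (Suc n) + 1 - int k = int n + 1 - int m" "int (Suc n) - int k = int n - int m"
      by (simp_all add: m)
    then show ?thesis
      unfolding r_def antiassoc_aux.simps(3)[of _ _ _ n] by (simp only: poly_of_real_pCons_mult)
  qed
  have Q: "K.Q x n = p n * S' - r n" for n
    unfolding p_def S'_def by (rule K.Q_eq_numerator[OF x r0 r_rec])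
  \<comment> \<open>Since \<open>k = Suc m\<close>, the coefficient is \<open>d 0\<close>, the last
    of the new ones.\<close>
  have "K.Q x (Suc m) = of_real (d (int (Suc m) - int k)) * A.Q x 0 * K.Q x m"
    by (rule Q_shift_proportional[OF A.three_term_orthogonal_axioms K.three_term_orthogonal_axioms _ _ x])
       (auto simp: m algebra_simps)
  then have "p k * S' - r k = of_real (d 0) * S * (p m * S' - r m)"
    unfolding Q S_def[symmetric] by (simp add: m)
  then have main: "(of_real (d 0) * p m * S - p k) * S' = of_real (d 0) * r m * S - r k"
    by (simp add: algebra_simps)
  \<comment> \<open>Up to the factor \<open>- d 0\<close> this is the determinant of the transfer
    matrix. The initial bracket is -1 and the product runs over \<open>d (1 - k)\<close> to
    \<open>d (-1)\<close>, all positive.\<close>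
  have "p (Suc m) * r m - p m * r (Suc m)
    = (\<Prod>i<m. complex_of_real (d (int (Suc i) - int k))) * (p 1 * r 0 - p 0 * r 1)"
    using casoratian_three_term[of p "\<lambda>n. x - of_real (b (int (Suc n) + 1 - int k))"
        "\<lambda>n. of_real (d (int (Suc n) - int k))" r] p_rec r_rec by blast
  moreover have "(\<Prod>i<m. complex_of_real (d (int (Suc i) - int k))) \<noteq> 0"
    using K.\<delta>_pos by (simp add: less_imp_neq[symmetric])
  ultimately have "p (Suc m) * r m - p m * r (Suc m) \<noteq> 0"
    by (simp only: One_nat_def r0 p0) simp
  then have cas: "p k * r m \<noteq> p m * r k"
    by (simp add: m)
  \<comment> \<open>A vanishing denominator would force the numerator in \<open>main\<close> to
    vanish too, making the rows of the matrix dependent against \<open>cas\<close>.\<close>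
  have den: "of_real (d 0) * p m * S - p k \<noteq> 0"
  proof
    assume 0: "of_real (d 0) * p m * S - p k = 0"
    then have "p k = of_real (d 0) * p m * S" "r k = of_real (d 0) * r m * S"
      using main by simp_all
    then show False using cas by simp
  qed
  \<comment> \<open>For \<open>k = 1\<close> the upper left entry has polynomial index -1, matching
    \<open>r 0 = 0\<close>.\<close>
  have "nat (int m + 1) = Suc m" "nat (2 + int m) = Suc (Suc m)" by auto
  then have B: "B_matrix b d k x $ 1 $ 1 = of_real (d 0) * r m" "B_matrix b d k x $ 1 $ 2 = - r k"
      "B_matrix b d k x $ 2 $ 1 = of_real (d 0) * p m" "B_matrix b d k x $ 2 $ 2 = - p k"
    by (simp_all add: B_matrix_def Let_def vector_2 d_tilde_def antiassoc_def p_def r_def m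
        del: antiassoc_aux.simps)
  show ?thesis
    unfolding F x_def[symmetric] dot_eq_def B moebius_def
    using den main by (simp add: field_simps)
qed

end
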